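(* Let $\mathfrak{J}:\mathcal{S}\to\mathbb{R}_{\ge 0}$ be a set function satisfying the standing assumptions given in the context. If $1\le\mathfrak{q}<\infty$, then $$\frac{\tau(0)}{\tau(0)-\tau(1)}\le\mathfrak{q}\le\frac{\dim_\infty(\mathfrak{J})+\tau(1)}{\dim_\infty(\mathfrak{J})}\le\frac{\tau(0)}{\dim_\infty(\mathfrak{J})}\le\frac{\overline{\dim}_M(\mathfrak{J})}{\dim_\infty(\mathfrak{J})}\le\frac{d}{\dim_\infty(\mathfrak{J})},$$ and if $\mathfrak{q}\le1$, then $$\frac{\dim_\infty(\mathfrak{J})+\tau(1)}{\dim_\infty(\mathfrak{J})}\le\mathfrak{q}\le\frac{\tau(0)}{\tau(0)-\tau(1)}\le\frac{\overline{\dim}_M(\mathfrak{J})}{\overline{\dim}_M(\mathfrak{J})-\tau(1)}.$$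
   Context: Dyadic cubes. Let $d\in\mathbb{N}$. A dyadic cube of side length $2^{-n}$ is a product $I_1\times\cdots\times I_d$ of intervals of length $2^{-n}$ (each half-open, open, or closed) with endpoints in $\{k2^{-n}:k\in\mathbb{Z}\}$. Fix a dyadic unit cube $\mathcal{Q}\subset\mathbb{R}^d$ and partitions $\mathcal{D}_n$ of $\mathcal{Q}$ into dyadic cubes of side length $2^{-n}$ with $\mathcal{D}_0=\{\mathcal{Q}\}$ and such that each element of $\mathcal{D}_n$ is the disjoint union of exactly $2^d$ elements of $\mathcal{D}_{n+1}$. Put $\mathcal{D}=\bigcup_{n\ge0}\mathcal{D}_n$. Fix a subset $\mathcal{S}\subset\mathcal{D}$ and put $\mathcal{S}_n=\mathcal{S}\cap\mathcal{D}_n$. Standing assumptions on $\mathfrak{J}:\mathcal{S}\to\mathbb{R}_{\ge0}$: (1) non-trivial: $\mathfrak{J}\not\equiv0$; (2) monotone: $Q\subset Q'$ in $\mathcal{S}$ implies $\mathfrak{J}(Q)\le\mathfrak{J}(Q')$; (3) uniformly vanishing: $j_n:=\sup\{\mathfrak{J}(Q):Q\in\bigcup_{k\ge n}\mathcal{S}_k\}\to0$ as $n\to\infty$; (4) locally non-vanishing: for every $n\ge 0$ and $Q\in\mathcal{S}_n$ with $\mathfrak{J}(Q)>0$ there is $Q'\in\mathcal{S}_{n+1}$ with $Q'\subset Q$ and $\mathfrak{J}(Q')>0$; (5) there exist $a>0$, $b\in\mathbb{R}$ with $\tau_n(a)\ge b$ for all large $n$ ($\tau_n$ defined below). Definitions.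 For $q\ge0$, $\tau_n(q)=\frac{1}{\log 2^n}\log\sum_{Q\in\mathcal{S}_n}\mathfrak{J}(Q)^q$ (with $0^0=0$) and $\tau(q)=\limsup_{n\to\infty}\tau_n(q)$; $\mathfrak{q}=\inf\{q\ge0:\tau(q)<0\}$ ($\inf\emptyset=\infty$); $\dim_\infty(\mathfrak{J})=\liminf_{n\to\infty}\frac{\log\max_{Q\in\mathcal{S}_n}\mathfrak{J}(Q)}{-\log 2^n}$. The support of $\mathfrak{J}$ is $\operatorname{supp}(\mathfrak{J})=\bigcap_{k\in\mathbb{N}}\overline{\bigcup_{n\ge k}\bigcup\{Q\in\mathcal{S}_n:\mathfrak{J}(Q)>0\}}$. The upper Minkowski dimension of a set $A\subset\mathcal{Q}$ is $\overline{\dim}_M(A)=\limsup_{n\to\infty}\frac{\log\operatorname{card}\{Q\in\mathcal{D}_n:Q\cap A\ne\emptyset\}}{\log2^n}\in[0,d]$, and, slightly abusing notation, $\overline{\dim}_M(\mathfrak{J})=\overline{\dim}_M(\operatorname{supp}(\mathfrak{J}))$.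
   Formalization: The upper Minkowski dimension of supp(J) counts closures of the cubes in D_n, since supp(J) may leave Q when Q is not closed and the literal count then makes the claim false; for subsets of Q the two counts give the same dimension. *)

theory Defs
  imports "HOL-Analysis.Analysis" "HOL-Library.Disjoint_Sets"
begin

text \<open>The dimension \<open>d\<close> is \<open>CARD('n)\<close>.\<close>

definition dyadic_interval :: "nat \<Rightarrow> real set \<Rightarrow> bool" where
  "dyadic_interval n I \<longleftrightarrow> (\<exists>k::int. \<exists>a b. a = of_int k / 2 ^ n \<and> b = (of_int k + 1) / 2 ^ n \<and>
     (I = {a..b} \<or> I = {a..<b} \<or> I = {a<..b} \<or> I = {a<..<b}))"

definition dyadic_cube :: "nat \<Rightarrow> (real ^ 'n) set \<Rightarrow> bool" where
  "dyadic_cube n Q \<longleftrightarrow> (\<exists>I :: 'n \<Rightarrow> real set. (\<forall>i. dyadic_interval n (I i)) \<and> Q = {x. \<forall>i. x $ i \<in> I i})"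

locale dyadic_partitions =
  fixes Q0 :: "(real ^ 'n) set" and D :: "nat \<Rightarrow> (real ^ 'n) set set"
  assumes unit_cube: "dyadic_cube 0 Q0"
    and D_0: "D 0 = {Q0}"
    and D_cube: "Q \<in> D n \<Longrightarrow> dyadic_cube n Q"
    and D_partition: "partition_on Q0 (D n)"
    and D_refine: "Q \<in> D n \<Longrightarrow> \<exists>F \<subseteq> D (Suc n). card F = 2 ^ CARD('n) \<and> partition_on Q F"

text \<open>
  Throughout, \<open>ln\<close> of an empty sum and \<open>Max {}\<close> only occur for finitely many \<open>n\<close> when \<open>J\<close> satisfies
  the standing assumptions below (by non-triviality and local non-vanishing), and so does the
  division by \<open>ln (2 ^ 0) = 0\<close>; none of this affects the upper and lower limits.
  The convention \<open>0\<^sup>0 = 0\<close> is the one built into \<open>powr\<close>.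
\<close>

definition tau_n :: "(nat \<Rightarrow> 'a set set) \<Rightarrow> 'a set set \<Rightarrow> ('a set \<Rightarrow> real) \<Rightarrow> nat \<Rightarrow> real \<Rightarrow> real" where
  "tau_n D S J n q = 1 / ln (2 ^ n) * ln (\<Sum>Q \<in> S \<inter> D n. J Q powr q)"

definition tau :: "(nat \<Rightarrow> 'a set set) \<Rightarrow> 'a set set \<Rightarrow> ('a set \<Rightarrow> real) \<Rightarrow> real \<Rightarrow> ereal" where
  "tau D S J q = limsup (\<lambda>n. ereal (tau_n D S J n q))"

definition crit_exp :: "(nat \<Rightarrow> 'a set set) \<Rightarrow> 'a set set \<Rightarrow> ('a set \<Rightarrow> real) \<Rightarrow> ereal" where
  "crit_exp D S J = Inf {ereal q | q. 0 \<le> q \<and> tau D S J q < 0}"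

definition dim_inf :: "(nat \<Rightarrow> 'a set set) \<Rightarrow> 'a set set \<Rightarrow> ('a set \<Rightarrow> real) \<Rightarrow> ereal" where
  "dim_inf D S J = liminf (\<lambda>n. ereal (ln (Max (J ` (S \<inter> D n))) / - ln (2 ^ n)))"

definition supp :: "(nat \<Rightarrow> 'a::topological_space set set) \<Rightarrow> 'a set set \<Rightarrow> ('a set \<Rightarrow> real) \<Rightarrow> 'a set" where
  "supp D S J = (\<Inter>k. closure (\<Union>n\<in>{k..}. \<Union>{Q \<in> S \<inter> D n. J Q > 0}))"

definition upper_minkowski_dim :: "(nat \<Rightarrow> 'a set set) \<Rightarrow> 'a set \<Rightarrow> ereal" where
  "upper_minkowski_dim D A =
     limsup (\<lambda>n. ereal (ln (real (card {Q \<in> D n. Q \<inter> A \<noteq> {}})) / ln (2 ^ n)))"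

text \<open>
  The set \<open>supp D S J\<close> is contained in the closure of \<open>Q0\<close>, but not in \<open>Q0\<close> in general; if, e.g.,
  \<open>Q0 = {0<..1}\<close> and \<open>J\<close> lives on the intervals \<open>{0<..1 / 2 ^ n}\<close>, then the support \<open>{0}\<close> meets no
  element of any \<open>D n\<close>. Its dimension is therefore computed by counting closed cubes.
  For subsets of \<open>Q0\<close> this changes nothing, see \<open>upper_minkowski_dim_closure\<close> below.
\<close>

definition dim_M :: "(nat \<Rightarrow> 'a::topological_space set set) \<Rightarrow> 'a set set \<Rightarrow> ('a set \<Rightarrow> real) \<Rightarrow> ereal" where
  "dim_M D S J = upper_minkowski_dim (\<lambda>n. closure ` D n) (supp D S J)"

lemma dyadic_cube_corner:
  fixes Q :: "(real ^ 'n) set"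
  assumes "dyadic_cube n Q"
  shows "\<exists>k :: 'n \<Rightarrow> int. (\<forall>x \<in> closure Q. \<forall>i. of_int (k i) / 2 ^ n \<le> x $ i \<and> x $ i \<le> (of_int (k i) + 1) / 2 ^ n)
    \<and> (\<chi> i. (of_int (k i) + 1 / 2) / 2 ^ n) \<in> Q"
proof -
  obtain I :: "'n \<Rightarrow> real set" where I: "\<And>i. dyadic_interval n (I i)" and Q: "Q = {x. \<forall>i. x $ i \<in> I i}"
    using assms unfolding dyadic_cube_def by blast
  have "\<forall>i. \<exists>k::int. I i \<subseteq> {of_int k / 2 ^ n .. (of_int k + 1) / 2 ^ n}
      \<and> {of_int k / 2 ^ n <..< (of_int k + 1) / 2 ^ n} \<subseteq> I i"
  proof
    fix i
    obtain k :: int where "I i = {of_int k / 2 ^ n .. (of_int k + 1) / 2 ^ n}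
       \<or> I i = {of_int k / 2 ^ n ..< (of_int k + 1) / 2 ^ n} \<or> I i = {of_int k / 2 ^ n <.. (of_int k + 1) / 2 ^ n}
       \<or> I i = {of_int k / 2 ^ n <..< (of_int k + 1) / 2 ^ n}"
      using I[of i] unfolding dyadic_interval_def by metis
    then have "I i \<subseteq> {of_int k / 2 ^ n .. (of_int k + 1) / 2 ^ n}
      \<and> {of_int k / 2 ^ n <..< (of_int k + 1) / 2 ^ n} \<subseteq> I i"
      by (elim disjE) (simp_all add: subset_iff)
    then show "\<exists>k::int. I i \<subseteq> {of_int k / 2 ^ n .. (of_int k + 1) / 2 ^ n}
      \<and> {of_int k / 2 ^ n <..< (of_int k + 1) / 2 ^ n} \<subseteq> I i" by blast
  qed
  then obtain k :: "'n \<Rightarrow> int" where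
    k: "\<And>i. I i \<subseteq> {of_int (k i) / 2 ^ n .. (of_int (k i) + 1) / 2 ^ n}"
       "\<And>i. {of_int (k i) / 2 ^ n <..< (of_int (k i) + 1) / 2 ^ n} \<subseteq> I i"
    by metis
  let ?C = "{x :: real ^ 'n. \<forall>i. of_int (k i) / 2 ^ n \<le> x $ i \<and> x $ i \<le> (of_int (k i) + 1) / 2 ^ n}"
  have "closed ?C"
    by (intro closed_Collect_all closed_Collect_conj closed_Collect_le continuous_intros)
  moreover have "Q \<subseteq> ?C"
    using k(1) by (fastforce simp: Q)
  ultimately have "closure Q \<subseteq> ?C"
    by (rule closure_minimal[rotated])
  moreover have "(of_int (k i) + 1 / 2) / 2 ^ n \<in> I i" for i
    by (rule subsetD[OF k(2)]) (simp add: divide_strict_right_mono)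
  ultimately show ?thesis
    by (intro exI[of _ k]) (auto simp: Q)
qed

context dyadic_partitions
begin

lemma D_disjoint: "Q \<in> D n \<Longrightarrow> Q' \<in> D n \<Longrightarrow> x \<in> Q \<Longrightarrow> x \<in> Q' \<Longrightarrow> Q = Q'"
  using D_partition[of n] by (auto simp: partition_on_def disjoint_def)

lemma finite_D: "finite (D n)"
proof (induction n)
  case (Suc n)
  have "\<forall>Q\<in>D n. \<exists>F. F \<subseteq> D (Suc n) \<and> card F = 2 ^ CARD('n) \<and> partition_on Q F"
    using D_refine by blast
  then obtain F where F: "\<And>Q. Q \<in> D n \<Longrightarrow> F Q \<subseteq> D (Suc n)" "\<And>Q. Q \<in> D n \<Longrightarrow> card (F Q) = 2 ^ CARD('n)"
     "\<And>Q. Q \<in> D n \<Longrightarrow> partition_on Q (F Q)"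
    by (metis (no_types))
  have fin: "finite (F Q)" if "Q \<in> D n" for Q
    using F(2)[OF that] by (intro card_ge_0_finite) simp
  have "D (Suc n) \<subseteq> (\<Union>Q\<in>D n. F Q)"
  proof
    fix C assume C: "C \<in> D (Suc n)"
    then obtain x where x: "x \<in> C"
      using D_partition[of "Suc n"] by (metis all_not_in_conv partition_onD3)
    then have "x \<in> Q0"
      using D_partition[of "Suc n"] C by (auto simp: partition_on_def)
    then obtain Q where Q: "Q \<in> D n" "x \<in> Q"
      using D_partition[of n] by (auto simp: partition_on_def)
    then obtain C' where C': "C' \<in> F Q" "x \<in> C'"
      using F(3)[OF Q(1)] by (auto simp: partition_on_def)
    then have "C' = C"
      using D_disjoint[of C' "Suc n" C x] C x F(1) Q by blast
    then show "C \<in> (\<Union>Q\<in>D n. F Q)"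
      using C' Q by blast
  qed
  then show ?case
    using Suc fin by (meson finite_UN_I finite_subset)
qed (simp add: D_0)

lemma upper_minkowski_dim_closure:
  assumes "A \<subseteq> Q0"
  shows "upper_minkowski_dim (\<lambda>n. closure ` D n) A = upper_minkowski_dim D A"
proof (cases "A = {}")
  case True
  then show ?thesis by (simp add: upper_minkowski_dim_def)
next
  case False
  define L where "L n = {Q \<in> D n. Q \<inter> A \<noteq> {}}" for n
  define B where "B n = {Q \<in> closure ` D n. Q \<inter> A \<noteq> {}}" for n
  define b where "b n = ln (3 ^ CARD('n)) / ln (2 ^ n :: real)" for n
  have fin: "finite (L n)" "finite (B n)" for n
    unfolding L_def B_def using finite_D[of n] by auto
  have L_pos: "card (L n) > 0" for n
    using False assms D_partition[of n] fin[of n]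
    by (auto simp: card_gt_0_iff L_def partition_on_def)
  have cards: "card (L n) \<le> card (B n) \<and> card (B n) \<le> 3 ^ CARD('n) * card (L n)" for n
  proof -
    have "\<forall>Q\<in>D n. \<exists>k :: 'n \<Rightarrow> int.
        (\<forall>x \<in> closure Q. \<forall>i. of_int (k i) / 2 ^ n \<le> x $ i \<and> x $ i \<le> (of_int (k i) + 1) / 2 ^ n)
        \<and> (\<chi> i. (of_int (k i) + 1 / 2) / 2 ^ n) \<in> Q"
      using dyadic_cube_corner D_cube by blast
    then obtain c :: "(real ^ 'n) set \<Rightarrow> 'n \<Rightarrow> int" where
      c: "\<And>Q x i. Q \<in> D n \<Longrightarrow> x \<in> closure Q \<Longrightarrow>
            of_int (c Q i) / 2 ^ n \<le> x $ i \<and> x $ i \<le> (of_int (c Q i) + 1) / 2 ^ n"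
      and m: "\<And>Q. Q \<in> D n \<Longrightarrow> (\<chi> i. (of_int (c Q i) + 1 / 2) / 2 ^ n) \<in> Q"
      by metis
    have c_near: "\<bar>c Q i - c P i\<bar> \<le> 1"
      if "Q \<in> D n" "P \<in> D n" "x \<in> closure Q" "x \<in> closure P" for Q P x i
    proof -
      have "real_of_int (c Q i) / 2 ^ n \<le> (of_int (c P i) + 1) / 2 ^ n"
           "real_of_int (c P i) / 2 ^ n \<le> (of_int (c Q i) + 1) / 2 ^ n"
        using c[OF that(1,3), of i] c[OF that(2,4), of i] by linarith+
      then have "real_of_int (c Q i) \<le> of_int (c P i) + 1" "real_of_int (c P i) \<le> of_int (c Q i) + 1"
        by (simp_all add: divide_le_cancel)
      then show ?thesis by linarith
    qed
    have inj_c: "inj_on c (D n)"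
      by (rule inj_onI) (metis D_disjoint m)
    have inj_closure: "inj_on closure (D n)"
    proof (rule inj_onI)
      fix Q P assume *: "Q \<in> D n" "P \<in> D n" "closure Q = closure P"
      have "c Q i = c P i" for i
      proof -
        have "(\<chi> i. (of_int (c Q i) + 1 / 2) / 2 ^ n) \<in> closure P"
          using m[OF *(1)] closure_subset *(3) by blast
        from c[OF *(2) this, of i]
        have "real_of_int (c P i) \<le> of_int (c Q i) + 1 / 2"
             "real_of_int (c Q i) + 1 / 2 \<le> of_int (c P i) + 1"
          by (simp_all add: divide_le_cancel)
        then show ?thesis by linarith
      qed
      then show "Q = P"
        using inj_onD[OF inj_c _ *(1,2)] by blast
    qed
    have "card (L n) = card (closure ` L n)"
      by (intro card_image[symmetric] inj_on_subset[OF inj_closure]) (auto simp: L_def)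
    also have "\<dots> \<le> card (B n)"
      using fin closure_subset by (intro card_mono) (auto simp: L_def B_def, blast)
    finally have le: "card (L n) \<le> card (B n)" .
    define N where "N P = {Q \<in> D n. \<forall>i. c Q i \<in> {c P i - 1..c P i + 1}}" for P
    have card_N: "card (N P) \<le> 3 ^ CARD('n)" for P
    proof -
      have "card (N P) \<le> card (\<Pi>\<^sub>E i\<in>UNIV. {c P i - 1..c P i + 1})"
      proof (rule card_inj_on_le[of c])
        show "inj_on c (N P)"
          by (rule inj_on_subset[OF inj_c]) (auto simp: N_def)
        show "c ` N P \<subseteq> (\<Pi>\<^sub>E i\<in>UNIV. {c P i - 1..c P i + 1})"
          by (auto simp: N_def)
        show "finite (\<Pi>\<^sub>E i\<in>UNIV. {c P i - 1..c P i + 1})"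
          by (intro finite_PiE) auto
      qed
      also have "\<dots> = 3 ^ CARD('n)"
        by (simp add: card_PiE)
      finally show ?thesis .
    qed
    have "B n \<subseteq> closure ` (\<Union>P\<in>L n. N P)"
    proof
      fix R assume "R \<in> B n"
      then obtain Q x where Q: "Q \<in> D n" "R = closure Q" "x \<in> closure Q" "x \<in> A"
        unfolding B_def by blast
      then obtain P where P: "P \<in> D n" "x \<in> P"
        using assms D_partition[of n] by (auto simp: partition_on_def)
      then have "P \<in> L n"
        using Q by (auto simp: L_def)
      moreover have "c Q i \<in> {c P i - 1..c P i + 1}" for i
      proof -
        have "\<bar>c Q i - c P i\<bar> \<le> 1"
          using P closure_subset by (intro c_near[OF Q(1) P(1) Q(3)]) blast
        then show ?thesis by (simp add: abs_le_iff)
      qed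
      then have "Q \<in> N P"
        using Q(1) unfolding N_def by blast
      ultimately show "R \<in> closure ` (\<Union>P\<in>L n. N P)"
        using Q by blast
    qed
    moreover have fin_N: "finite (\<Union>P\<in>L n. N P)"
      using fin finite_D[of n] by (auto simp: N_def)
    ultimately have "card (B n) \<le> card (\<Union>P\<in>L n. N P)"
      by (meson card_image_le card_mono finite_imageI le_trans)
    also have "\<dots> \<le> (\<Sum>P\<in>L n. card (N P))"
      by (rule card_UN_le[OF fin(1)])
    also have "\<dots> \<le> (\<Sum>P\<in>L n. 3 ^ CARD('n))"
      by (intro sum_mono card_N)
    finally show ?thesis
      using le by (simp add: mult.commute)
  qed
  have bounds: "ln (real (card (L n))) / ln (2 ^ n) \<le> ln (real (card (B n))) / ln (2 ^ n)"
    "ln (real (card (B n))) / ln (2 ^ n) \<le> b n + ln (real (card (L n))) / ln (2 ^ n)" for n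
  proof -
    have pos: "card (B n) > 0"
      using cards[of n] L_pos[of n] by linarith
    have nn: "0 \<le> ln (2 ^ n :: real)"
      by simp
    have "ln (real (card (B n))) \<le> ln (3 ^ CARD('n) * real (card (L n)))"
      using cards[of n] pos L_pos[of n]
      by (metis (no_types, lifting) ln_mono of_nat_0_less_iff of_nat_le_iff of_nat_mult of_nat_numeral of_nat_power)
    also have "\<dots> = ln (3 ^ CARD('n)) + ln (real (card (L n)))"
      using L_pos[of n] by (intro ln_mult_pos) auto
    finally show "ln (real (card (B n))) / ln (2 ^ n) \<le> b n + ln (real (card (L n))) / ln (2 ^ n)"
      unfolding b_def add_divide_distrib[symmetric] using nn by (rule divide_right_mono)
    show "ln (real (card (L n))) / ln (2 ^ n) \<le> ln (real (card (B n))) / ln (2 ^ n)"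
      using cards[of n] L_pos[of n] nn by (intro divide_right_mono) (auto intro!: ln_mono)
  qed
  have "b = (\<lambda>n. ln (3 ^ CARD('n)) / ln 2 * (1 / real n))"
    by (auto simp: b_def ln_realpow fun_eq_iff)
  also have "\<dots> \<longlonglongrightarrow> ln (3 ^ CARD('n)) / ln 2 * 0"
    by (intro tendsto_intros lim_1_over_n)
  finally have "(\<lambda>n. ereal (b n)) \<longlonglongrightarrow> 0"
    by (simp add: zero_ereal_def)
  then have "limsup (\<lambda>n. ereal (b n) + ereal (ln (real (card (L n))) / ln (2 ^ n)))
      = 0 + limsup (\<lambda>n. ereal (ln (real (card (L n))) / ln (2 ^ n)))"
    by (rule ereal_limsup_lim_add) simp
  moreover have "limsup (\<lambda>n. ereal (ln (real (card (B n))) / ln (2 ^ n)))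
      \<le> limsup (\<lambda>n. ereal (b n) + ereal (ln (real (card (L n))) / ln (2 ^ n)))"
    using bounds by (intro Limsup_mono always_eventually) simp
  moreover have "limsup (\<lambda>n. ereal (ln (real (card (L n))) / ln (2 ^ n)))
      \<le> limsup (\<lambda>n. ereal (ln (real (card (B n))) / ln (2 ^ n)))"
    using bounds by (intro Limsup_mono always_eventually) simp
  ultimately show ?thesis
    unfolding upper_minkowski_dim_def L_def[symmetric] B_def[symmetric] by simp
qed

end

locale dyadic_set_function = dyadic_partitions Q0 D
  for Q0 :: "(real ^ 'n) set" and D :: "nat \<Rightarrow> (real ^ 'n) set set" +
  fixes S :: "(real ^ 'n) set set" and J :: "(real ^ 'n) set \<Rightarrow> real"
  assumes S_subset: "S \<subseteq> (\<Union>n. D n)"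
    and nonneg: "Q \<in> S \<Longrightarrow> 0 \<le> J Q"
    and nontrivial: "\<exists>Q\<in>S. J Q \<noteq> 0"
    and monotone: "Q \<in> S \<Longrightarrow> Q' \<in> S \<Longrightarrow> Q \<subseteq> Q' \<Longrightarrow> J Q \<le> J Q'"
    and uniformly_vanishing:
      "(\<lambda>n. SUP Q \<in> (\<Union>k\<in>{n..}. S \<inter> D k). ereal (J Q)) \<longlonglongrightarrow> 0"
    and locally_nonvanishing:
      "Q \<in> S \<inter> D n \<Longrightarrow> J Q > 0 \<Longrightarrow> \<exists>Q' \<in> S \<inter> D (Suc n). Q' \<subseteq> Q \<and> J Q' > 0"
    and tau_n_bounded_below:
      "\<exists>a b. a > 0 \<and> (\<forall>\<^sub>F n in sequentially. tau_n D S J n a \<ge> b)"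

end

theory Submission
  imports Defs
begin

text \<open>
  Everything follows from three properties of \<open>\<tau>\<close> on \<open>[0, \<infinity>)\<close>, where \<open>\<delta>\<close> denotes
  \<^term>\<open>dim_inf D S J\<close> and \<open>q\<^sub>c\<close> the critical exponent:
  \<^item> \<open>\<tau>\<close> is convex (\<open>tau_convex\<close>), by the inequality of Hoelder for power sums;
  \<^item> \<open>\<tau>(p + r) \<le> \<tau>(p) - r \<delta>\<close> (\<open>tau_add_le\<close>), by pulling out the largest factors \<open>J(Q)\<^sup>r\<close>;
  \<^item> \<open>\<tau>(q) \<ge> - q \<delta>\<close> (\<open>tau_ge\<close>), by keeping only the largest summand.

  Together with \<open>0 \<le> \<tau>(0) \<le> dim\<^sub>M \<le> d\<close> and \<open>\<delta> < \<infinity>\<close>, these make all quantities finite. If \<open>q\<^sub>c\<close>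
  is finite, then \<open>\<tau>\<close> takes a negative value and the third property forces \<open>\<delta> > 0\<close>; the second
  one then gives \<open>\<tau>(0) - \<tau>(1) \<ge> \<delta> > 0\<close>, so that every denominator is positive.

  The two interesting bounds on \<open>q\<^sub>c\<close> compare \<open>\<tau>\<close> with two lines through \<open>(1, \<tau>(1))\<close>.
  The chord through \<open>(0, \<tau>(0))\<close> vanishes at \<open>\<tau>(0) / (\<tau>(0) - \<tau>(1))\<close>; by convexity \<open>\<tau>\<close> lies below
  it on \<open>[0, 1]\<close> and above it on \<open>[1, \<infinity>)\<close>. The line of slope \<open>- \<delta>\<close> vanishes at \<open>1 + \<tau>(1) / \<delta>\<close>;
  \<open>\<tau>\<close> lies above it on \<open>[0, 1]\<close> and below it on \<open>[1, \<infinity>)\<close>. Depending on the sign of \<open>\<tau>(1)\<close>, the zeros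
  of these lines lie on the same side of \<open>1\<close> as \<open>q\<^sub>c\<close>, which gives the lower and upper bounds.

  The comparison \<open>\<tau>(0) \<le> dim\<^sub>M\<close> (\<open>tau_0_le_dim_M\<close>) rests on the geometry of the cubes: local
  non-vanishing and compactness put a point of the support into the closure of every
  cube on which \<open>J\<close> is positive.
\<close>

section \<open>Power sums\<close>

text \<open>
  Log-convexity of power sums, that is, the inequality of Hoelder with exponents \<open>1 / (1 - t)\<close> and
  \<open>1 / t\<close>: after normalising both sums to \<open>1\<close>, it is Young's inequality summed over \<open>P\<close>.
\<close>
lemma ln_sum_powr_convex:
  fixes f :: "'a \<Rightarrow> real"
  assumes "finite P" "P \<noteq> {}" "\<And>x. x \<in> P \<Longrightarrow> 0 < f x" "0 \<le> t" "t \<le> 1"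
  shows "ln (\<Sum>x\<in>P. f x powr ((1 - t) * p + t * q))
    \<le> (1 - t) * ln (\<Sum>x\<in>P. f x powr p) + t * ln (\<Sum>x\<in>P. f x powr q)"
proof -
  define A where "A = (\<Sum>x\<in>P. f x powr p)"
  define B where "B = (\<Sum>x\<in>P. f x powr q)"
  have pos: "0 < (\<Sum>x\<in>P. f x powr r)" for r
    using assms by (intro sum_pos) (auto dest: assms(3))
  then have AB: "0 < A" "0 < B"
    by (simp_all add: A_def B_def)
  have summand_le: "f x powr ((1 - t) * p + t * q)
      \<le> A powr (1 - t) * B powr t * ((1 - t) * (f x powr p / A) + t * (f x powr q / B))"
    if x: "x \<in> P" for x
  proof -
    have "f x powr ((1 - t) * p + t * q) = (f x powr p) powr (1 - t) * (f x powr q) powr t"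
      by (simp add: powr_add powr_powr mult.commute)
    also have "\<dots> = A powr (1 - t) * B powr t * ((f x powr p / A) powr (1 - t) * (f x powr q / B) powr t)"
      using AB by (simp add: powr_divide)
    also have "\<dots> \<le> A powr (1 - t) * B powr t * ((1 - t) * (f x powr p / A) + t * (f x powr q / B))"
      using AB assms(3)[OF x] assms(4,5)
      by (intro mult_left_mono Youngs_inequality_0) auto
    finally show ?thesis .
  qed
  have "(\<Sum>x\<in>P. f x powr ((1 - t) * p + t * q))
      \<le> (\<Sum>x\<in>P. A powr (1 - t) * B powr t * ((1 - t) * (f x powr p / A) + t * (f x powr q / B)))"
    by (intro sum_mono summand_le)
  also have "\<dots> = A powr (1 - t) * B powr t * ((1 - t) * (A / A) + t * (B / B))"
    by (simp add: sum_distrib_left[symmetric] sum.distrib sum_divide_distrib[symmetric] A_def B_def)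
  also have "\<dots> = A powr (1 - t) * B powr t"
    using AB by simp
  finally have "ln (\<Sum>x\<in>P. f x powr ((1 - t) * p + t * q)) \<le> ln (A powr (1 - t) * B powr t)"
    using pos by (intro ln_mono) auto
  also have "\<dots> = (1 - t) * ln A + t * ln B"
    using AB by (simp add: ln_mult)
  finally show ?thesis
    by (simp add: A_def B_def)
qed

section \<open>Dyadic cubes\<close>

lemma compact_closure_dyadic_cube:
  fixes Q :: "(real ^ 'n) set"
  assumes "dyadic_cube n Q"
  shows "compact (closure Q)"
proof -
  obtain k :: "'n \<Rightarrow> int" where
    k: "\<And>x i. x \<in> closure Q \<Longrightarrow> of_int (k i) / 2 ^ n \<le> x $ i \<and> x $ i \<le> (of_int (k i) + 1) / 2 ^ n"
    using dyadic_cube_corner[OF assms] by blast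
  have "closure Q \<subseteq> cbox (\<chi> i. of_int (k i) / 2 ^ n) (\<chi> i. (of_int (k i) + 1) / 2 ^ n)"
    using k by (auto simp: mem_box_cart)
  then have "bounded (closure Q)"
    using bounded_cbox bounded_subset by blast
  then show ?thesis
    by (simp add: compact_eq_bounded_closed)
qed

context dyadic_partitions
begin

lemma nonempty_D: "Q \<in> D n \<Longrightarrow> Q \<noteq> {}"
  using D_partition[of n] by (metis partition_onD3)

text \<open>
  The closure of a cube determines its corner up to less than one side length, because the centre
  of one cube lies in the closed other one; so the corners, and hence the centres, agree, and two
  elements of a partition with a common point are equal.
\<close>
lemma inj_on_closure_D: "inj_on closure (D n)"
proof (rule inj_onI)
  fix Q P assume *: "Q \<in> D n" "P \<in> D n" "closure Q = closure P"
  obtain k l :: "'n \<Rightarrow> int" where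
    k: "\<And>x i. x \<in> closure Q \<Longrightarrow> of_int (k i) / 2 ^ n \<le> x $ i \<and> x $ i \<le> (of_int (k i) + 1) / 2 ^ n"
       "(\<chi> i. (of_int (k i) + 1 / 2) / 2 ^ n) \<in> Q" and
    l: "\<And>x i. x \<in> closure P \<Longrightarrow> of_int (l i) / 2 ^ n \<le> x $ i \<and> x $ i \<le> (of_int (l i) + 1) / 2 ^ n"
       "(\<chi> i. (of_int (l i) + 1 / 2) / 2 ^ n) \<in> P"
    using dyadic_cube_corner[OF D_cube[OF *(1)]] dyadic_cube_corner[OF D_cube[OF *(2)]] by blast
  have "k i = l i" for i
  proof -
    have "(\<chi> i. (of_int (k i) + 1 / 2) / 2 ^ n) \<in> closure P"
      using k(2) closure_subset *(3) by blast
    from l(1)[OF this, of i]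
    have "real_of_int (l i) \<le> of_int (k i) + 1 / 2" "real_of_int (k i) + 1 / 2 \<le> of_int (l i) + 1"
      by (simp_all add: divide_le_cancel)
    then show ?thesis by linarith
  qed
  then show "Q = P"
    using D_disjoint[OF *(1,2)] k(2) l(2) by simp
qed

lemma card_D_le: "card (D n) \<le> (2 ^ CARD('n)) ^ n"
proof (induction n)
  case (Suc n)
  have "\<forall>Q\<in>D n. \<exists>F. F \<subseteq> D (Suc n) \<and> card F = 2 ^ CARD('n) \<and> partition_on Q F"
    using D_refine by blast
  then obtain F where F: "\<And>Q. Q \<in> D n \<Longrightarrow> F Q \<subseteq> D (Suc n)" "\<And>Q. Q \<in> D n \<Longrightarrow> card (F Q) = 2 ^ CARD('n)"
     "\<And>Q. Q \<in> D n \<Longrightarrow> partition_on Q (F Q)"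
    by (metis (no_types))
  have "D (Suc n) \<subseteq> (\<Union>Q\<in>D n. F Q)"
  proof
    fix C assume C: "C \<in> D (Suc n)"
    then obtain x where x: "x \<in> C"
      using nonempty_D by blast
    then have "x \<in> Q0"
      using D_partition[of "Suc n"] C by (auto simp: partition_on_def)
    then obtain Q where Q: "Q \<in> D n" "x \<in> Q"
      using D_partition[of n] by (auto simp: partition_on_def)
    then obtain C' where C': "C' \<in> F Q" "x \<in> C'"
      using F(3)[OF Q(1)] by (auto simp: partition_on_def)
    then have "C' = C"
      using D_disjoint[of C' "Suc n" C x] C x F(1) Q by blast
    then show "C \<in> (\<Union>Q\<in>D n. F Q)"
      using C' Q by blast
  qed
  then have "card (D (Suc n)) \<le> card (\<Union>Q\<in>D n. F Q)"
    using F(1) finite_D by (intro card_mono finite_UN_I) (auto intro: finite_subset[OF F(1)])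
  also have "\<dots> \<le> (\<Sum>Q\<in>D n. card (F Q))"
    by (rule card_UN_le[OF finite_D])
  also have "\<dots> = 2 ^ CARD('n) * card (D n)"
    using F(2) by simp
  also have "\<dots> \<le> 2 ^ CARD('n) * (2 ^ CARD('n)) ^ n"
    by (intro mult_left_mono Suc.IH) simp
  finally show ?case by simp
qed (simp add: D_0)

lemma ln_card_le_dim:
  assumes "1 \<le> n" "0 < m" "m \<le> card (D n)"
  shows "ln (real m) / ln (2 ^ n) \<le> real CARD('n)"
proof -
  have "real m \<le> real ((2 ^ CARD('n)) ^ n)"
    using card_D_le[of n] assms by (intro of_nat_mono) linarith
  then have "ln (real m) \<le> ln ((2 ^ CARD('n)) ^ n)"
    using assms by (intro ln_mono) auto
  also have "\<dots> = real CARD('n) * ln (2 ^ n)"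
    by (simp add: ln_realpow)
  finally show ?thesis
    using assms by (simp add: divide_le_eq)
qed

end

section \<open>The exponents of a set function\<close>

context dyadic_set_function
begin

definition positive_cubes :: "nat \<Rightarrow> (real ^ 'n) set set" where
  "positive_cubes n = {Q \<in> S \<inter> D n. 0 < J Q}"

definition max_J :: "nat \<Rightarrow> real" where
  "max_J n = Max (J ` (S \<inter> D n))"

lemma finite_positive_cubes: "finite (positive_cubes n)"
  using finite_D[of n] by (simp add: positive_cubes_def)

lemma positive_cubes_descend:
  assumes "Q \<in> positive_cubes n"
  shows "\<exists>Q'\<in>positive_cubes (Suc n). Q' \<subseteq> Q"
  using locally_nonvanishing[of Q n] assms by (auto simp: positive_cubes_def)

lemma eventually_positive_cubes: "\<forall>\<^sub>F n in sequentially. positive_cubes n \<noteq> {}"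
proof -
  obtain Q where "Q \<in> S" "0 < J Q"
    using nontrivial nonneg by (metis less_eq_real_def)
  then obtain m where m: "Q \<in> positive_cubes m"
    using S_subset by (auto simp: positive_cubes_def)
  have "positive_cubes n \<noteq> {}" if "m \<le> n" for n
    using that by (induction rule: dec_induct) (use m positive_cubes_descend in blast)+
  then show ?thesis
    by (auto simp: eventually_sequentially)
qed

lemma eventually_J_less_1: "\<forall>\<^sub>F n in sequentially. \<forall>Q\<in>S \<inter> D n. J Q < 1"
proof -
  have "\<forall>\<^sub>F n in sequentially. (SUP Q \<in> (\<Union>k\<in>{n..}. S \<inter> D k). ereal (J Q)) < 1"
    using uniformly_vanishing by (rule order_tendstoD) simp
  then show ?thesis
  proof (rule eventually_mono)
    fix n assume *: "(SUP Q \<in> (\<Union>k\<in>{n..}. S \<inter> D k). ereal (J Q)) < 1"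
    show "\<forall>Q\<in>S \<inter> D n. J Q < 1"
    proof
      fix Q assume "Q \<in> S \<inter> D n"
      then have "ereal (J Q) \<le> (SUP Q \<in> (\<Union>k\<in>{n..}. S \<inter> D k). ereal (J Q))"
        by (intro SUP_upper) auto
      with * show "J Q < 1"
        by (metis order.strict_trans1 one_ereal_def less_ereal.simps(1))
    qed
  qed
qed

text \<open>
  Since \<open>0 powr q = 0\<close> even for \<open>q = 0\<close>, cubes of value \<open>0\<close> never contribute to \<open>\<tau>\<^sub>n\<close>. On the remaining
  cubes, power sums are positive and logarithms behave as expected.
\<close>
lemma tau_n_positive_cubes:
  "tau_n D S J n q = ln (\<Sum>Q\<in>positive_cubes n. J Q powr q) / ln (2 ^ n)"
proof -
  have "(\<Sum>Q\<in>S \<inter> D n. J Q powr q) = (\<Sum>Q\<in>positive_cubes n. J Q powr q)"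
    using finite_D[of n] nonneg
    by (intro sum.mono_neutral_right) (auto simp: positive_cubes_def less_eq_real_def)
  then show ?thesis
    by (simp add: tau_n_def)
qed

lemma max_J_bounds:
  assumes "positive_cubes n \<noteq> {}"
  shows "0 < max_J n" and "Q \<in> positive_cubes n \<Longrightarrow> J Q \<le> max_J n"
    and "\<exists>Q\<in>positive_cubes n. J Q = max_J n"
proof -
  have fin: "finite (J ` (S \<inter> D n))"
    using finite_D[of n] by simp
  obtain P where P: "P \<in> positive_cubes n"
    using assms by blast
  show le: "J Q \<le> max_J n" if "Q \<in> positive_cubes n" for Q
    using that fin by (auto simp: max_J_def positive_cubes_def intro!: Max_ge)
  show pos: "0 < max_J n"
    using le[OF P] P by (auto simp: positive_cubes_def)
  have "max_J n \<in> J ` (S \<inter> D n)"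
    unfolding max_J_def using fin P by (intro Max_in) (auto simp: positive_cubes_def)
  then show "\<exists>Q\<in>positive_cubes n. J Q = max_J n"
    using pos by (auto simp: positive_cubes_def)
qed

text \<open>
  The sign in the definition of \<^term>\<open>dim_inf D S J\<close> turns its lower limit into an upper limit,
  which is the form that can be added to the upper limit defining \<open>\<tau>\<close>.
\<close>
lemma limsup_scaled_max_J:
  assumes "0 \<le> r"
  shows "limsup (\<lambda>n. ereal (r * (ln (max_J n) / ln (2 ^ n)))) = - (ereal r * dim_inf D S J)"
proof -
  have "limsup (\<lambda>n. ereal (ln (max_J n) / ln (2 ^ n))) = - dim_inf D S J"
    unfolding dim_inf_def max_J_def[symmetric] ereal_Limsup_uminus[symmetric] by simp
  moreover have "limsup (\<lambda>n. ereal (r * (ln (max_J n) / ln (2 ^ n))))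
      = limsup (\<lambda>n. ereal r * ereal (ln (max_J n) / ln (2 ^ n)))"
    by simp
  ultimately show ?thesis
    by (simp only: limsup_ereal_mult_left[OF assms] ereal_mult_minus_right)
qed

text \<open>Each summand satisfies \<open>J(Q)\<^sup>p\<^sup>+\<^sup>r \<le> J(Q)\<^sup>p m\<^sup>r\<close>, where \<open>m\<close> is the maximum of \<open>J\<close> at level \<open>n\<close>.\<close>
lemma tau_n_add_le:
  assumes "positive_cubes n \<noteq> {}" "0 \<le> r"
  shows "tau_n D S J n (p + r) \<le> tau_n D S J n p + r * (ln (max_J n) / ln (2 ^ n))"
proof -
  let ?\<Sigma> = "\<lambda>p. \<Sum>Q\<in>positive_cubes n. J Q powr p"
  have pos: "0 < ?\<Sigma> p" for p
    using assms finite_positive_cubes by (intro sum_pos) (auto simp: positive_cubes_def)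
  have "?\<Sigma> (p + r) \<le> (\<Sum>Q\<in>positive_cubes n. J Q powr p * max_J n powr r)"
    using max_J_bounds(2)[OF assms(1)] assms(2)
    by (intro sum_mono) (auto simp: powr_add positive_cubes_def intro!: mult_left_mono powr_mono2)
  also have "\<dots> = ?\<Sigma> p * max_J n powr r"
    by (simp add: sum_distrib_right)
  finally have "ln (?\<Sigma> (p + r)) \<le> ln (?\<Sigma> p * max_J n powr r)"
    using pos by (intro ln_mono) auto
  also have "\<dots> = ln (?\<Sigma> p) + r * ln (max_J n)"
    using pos[of p] max_J_bounds(1)[OF assms(1)] by (simp add: ln_mult)
  finally show ?thesis
    unfolding tau_n_positive_cubes
    by (simp add: add_divide_distrib[symmetric] divide_right_mono)
qed

lemma tau_add_le:
  assumes "0 \<le> r"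
  shows "tau D S J (p + r) \<le> tau D S J p - ereal r * dim_inf D S J"
proof -
  have "tau D S J (p + r)
      \<le> limsup (\<lambda>n. ereal (tau_n D S J n p) + ereal (r * (ln (max_J n) / ln (2 ^ n))))"
    unfolding tau_def
    by (intro Limsup_mono eventually_mono[OF eventually_positive_cubes])
      (simp add: tau_n_add_le[OF _ assms] del: times_divide_eq_right)
  also have "\<dots> \<le> tau D S J p + - (ereal r * dim_inf D S J)"
    unfolding tau_def limsup_scaled_max_J[OF assms, symmetric] by (rule ereal_limsup_add_mono)
  finally show ?thesis
    by (simp add: minus_ereal_def)
qed

text \<open>The power sum is at least its largest term.\<close>
lemma tau_ge:
  assumes "0 \<le> q"
  shows "- (ereal q * dim_inf D S J) \<le> tau D S J q"
proof -
  have "q * (ln (max_J n) / ln (2 ^ n)) \<le> tau_n D S J n q" if ne: "positive_cubes n \<noteq> {}" for n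
  proof -
    obtain Q where Q: "Q \<in> positive_cubes n" "J Q = max_J n"
      using max_J_bounds(3)[OF ne] by blast
    have "max_J n powr q \<le> (\<Sum>Q\<in>positive_cubes n. J Q powr q)"
      using Q finite_positive_cubes by (auto simp flip: Q(2) intro!: member_le_sum)
    then have "q * ln (max_J n) \<le> ln (\<Sum>Q\<in>positive_cubes n. J Q powr q)"
      using max_J_bounds(1)[OF ne] by (metis ln_mono ln_powr powr_gt_zero less_irrefl)
    then show ?thesis
      unfolding tau_n_positive_cubes by (simp add: divide_right_mono)
  qed
  then show ?thesis
    unfolding tau_def limsup_scaled_max_J[OF assms, symmetric]
    using eventually_positive_cubes by (intro Limsup_mono) (auto elim!: eventually_mono)
qed

lemma tau_convex:
  assumes "0 \<le> t" "t \<le> 1"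
  shows "tau D S J ((1 - t) * p + t * q) \<le> ereal (1 - t) * tau D S J p + ereal t * tau D S J q"
proof -
  have *: "tau_n D S J n ((1 - t) * p + t * q) \<le> (1 - t) * tau_n D S J n p + t * tau_n D S J n q"
    if "positive_cubes n \<noteq> {}" for n
    using divide_right_mono[OF ln_sum_powr_convex[OF finite_positive_cubes that _ assms, of J p q], of "ln (2 ^ n)"]
    by (simp add: tau_n_positive_cubes positive_cubes_def add_divide_distrib)
  have "tau D S J ((1 - t) * p + t * q)
      \<le> limsup (\<lambda>n. ereal (1 - t) * ereal (tau_n D S J n p) + ereal t * ereal (tau_n D S J n q))"
    unfolding tau_def
    by (intro Limsup_mono eventually_mono[OF eventually_positive_cubes]) (simp add: *)
  also have "\<dots> \<le> limsup (\<lambda>n. ereal (1 - t) * ereal (tau_n D S J n p))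
      + limsup (\<lambda>n. ereal t * ereal (tau_n D S J n q))"
    by (rule ereal_limsup_add_mono)
  also have "\<dots> = ereal (1 - t) * tau D S J p + ereal t * tau D S J q"
    unfolding tau_def using assms by (subst (1 2) limsup_ereal_mult_left) auto
  finally show ?thesis .
qed

text \<open>Uniform vanishing makes the maximum of \<open>J\<close> at level \<open>n\<close> eventually smaller than \<open>1\<close>.\<close>
lemma dim_inf_nonneg: "0 \<le> dim_inf D S J"
  unfolding dim_inf_def max_J_def[symmetric]
proof (rule Liminf_bounded, use eventually_J_less_1 eventually_positive_cubes in eventually_elim)
  case (elim n)
  obtain Q where "Q \<in> positive_cubes n" "J Q = max_J n"
    using max_J_bounds(3)[OF elim(2)] by blast
  then have "0 < max_J n" "max_J n < 1"
    using elim(1) unfolding positive_cubes_def by force+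
  then have "ln (max_J n) / ln (2 ^ n) \<le> 0"
    by (intro divide_nonpos_nonneg) auto
  then show ?case by simp
qed

lemma tau_0_nonneg: "0 \<le> tau D S J 0"
  using tau_ge[of 0] by (simp flip: zero_ereal_def)

text \<open>
  At exponent \<open>0\<close> the power sum counts the cubes \<open>Q\<close> with \<open>J(Q) > 0\<close>. By local non-vanishing, such a
  cube starts a decreasing sequence of cubes with the same property. The closures are compact, so
  they have a common point; it belongs to the support. Hence the closure of \<open>Q\<close> is one of the sets
  counted by the Minkowski dimension, and distinct cubes have distinct closures.
\<close>
lemma tau_0_le_dim_M: "tau D S J 0 \<le> dim_M D S J"
proof -
  define B where "B n = {R \<in> closure ` D n. R \<inter> supp D S J \<noteq> {}}" for n
  have meets: "closure Q \<inter> supp D S J \<noteq> {}" if Q: "Q \<in> positive_cubes n" for Q n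
  proof -
    have "\<exists>C. \<forall>m. (C m \<in> positive_cubes (n + m) \<and> (m = 0 \<longrightarrow> C m = Q)) \<and> C (Suc m) \<subseteq> C m"
    proof (rule dependent_nat_choice)
      show "\<exists>C. C \<in> positive_cubes (n + 0) \<and> (0 = (0::nat) \<longrightarrow> C = Q)"
        using Q by simp
      show "\<exists>C'. (C' \<in> positive_cubes (n + Suc m) \<and> (Suc m = 0 \<longrightarrow> C' = Q)) \<and> C' \<subseteq> C"
        if "C \<in> positive_cubes (n + m) \<and> (m = 0 \<longrightarrow> C = Q)" for C m
        using positive_cubes_descend[of C "n + m"] that by auto
    qed
    then obtain C where C: "C 0 = Q" "\<And>m. C m \<in> positive_cubes (n + m)" "\<And>m. C (Suc m) \<subseteq> C m"
      by blast
    have anti: "C m \<subseteq> C l" if "l \<le> m" for l m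
      using lift_Suc_antimono_le[of C] C(3) that by blast
    have "(\<Inter>m. closure (C m)) \<noteq> {}"
    proof (rule compact_nest)
      show "compact (closure (C m))" for m
        using C(2)[of m] D_cube by (intro compact_closure_dyadic_cube) (auto simp: positive_cubes_def)
      show "closure (C m) \<noteq> {}" for m
        using C(2)[of m] nonempty_D by (auto simp: positive_cubes_def)
      show "closure (C m) \<subseteq> closure (C l)" if "l \<le> m" for l m
        using anti[OF that] by (rule closure_mono)
    qed
    then obtain x where x: "\<And>m. x \<in> closure (C m)"
      by blast
    have "x \<in> closure (\<Union>n\<in>{k..}. \<Union>{Q \<in> S \<inter> D n. J Q > 0})" for k
    proof (rule subsetD[OF closure_mono x[of k]])
      show "C k \<subseteq> (\<Union>n\<in>{k..}. \<Union>{Q \<in> S \<inter> D n. J Q > 0})"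
        using C(2)[of k] by (fastforce simp: positive_cubes_def)
    qed
    then have "x \<in> supp D S J"
      by (simp add: supp_def)
    then show ?thesis
      using x[of 0] C(1) by blast
  qed
  have "card (positive_cubes n) \<le> card (B n)" for n
  proof (rule card_inj_on_le[of closure])
    show "inj_on closure (positive_cubes n)"
      by (rule inj_on_subset[OF inj_on_closure_D[of n]]) (auto simp: positive_cubes_def)
    show "closure ` positive_cubes n \<subseteq> B n"
      using meets by (auto simp: B_def positive_cubes_def)
    show "finite (B n)"
      using finite_D[of n] by (simp add: B_def)
  qed
  then have "ln (real (card (positive_cubes n))) / ln (2 ^ n) \<le> ln (real (card (B n))) / ln (2 ^ n)"
    if "positive_cubes n \<noteq> {}" for n
    using that finite_positive_cubes[of n]
    by (intro divide_right_mono ln_mono) (auto simp: card_gt_0_iff)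
  moreover have "tau_n D S J n 0 = ln (real (card (positive_cubes n))) / ln (2 ^ n)" for n
  proof -
    have "(\<Sum>Q\<in>positive_cubes n. J Q powr 0) = (\<Sum>Q\<in>positive_cubes n. 1)"
      by (intro sum.cong) (auto simp: positive_cubes_def)
    then show ?thesis
      by (simp add: tau_n_positive_cubes)
  qed
  ultimately show ?thesis
    unfolding tau_def dim_M_def upper_minkowski_dim_def B_def[symmetric]
    using eventually_positive_cubes by (intro Limsup_mono) (auto elim!: eventually_mono)
qed

lemma dim_M_le: "dim_M D S J \<le> ereal (real CARD('n))"
  unfolding dim_M_def upper_minkowski_dim_def
proof (rule Limsup_bounded, use eventually_ge_at_top[of 1] in eventually_elim)
  case (elim n)
  let ?m = "card {R \<in> closure ` D n. R \<inter> supp D S J \<noteq> {}}"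
  have "?m \<le> card (closure ` D n)"
    using finite_D[of n] by (intro card_mono) auto
  also have "\<dots> \<le> card (D n)"
    by (rule card_image_le[OF finite_D])
  finally have m: "?m \<le> card (D n)" .
  show ?case
  proof (cases "?m = 0")
    case False
    then show ?thesis
      using ln_card_le_dim[OF elim _ m] by simp
  qed simp
qed

text \<open>
  An infinite value would make \<open>\<tau>(a) \<le> \<tau>(0) - a \<delta>\<close> equal to \<open>-\<infinity>\<close> for every \<open>a > 0\<close>, against the
  assumed lower bound for \<open>\<tau>\<^sub>n(a)\<close>.
\<close>
lemma dim_inf_finite: "dim_inf D S J < \<infinity>"
proof (rule ccontr)
  assume "\<not> ?thesis"
  then have inf: "dim_inf D S J = \<infinity>" by simp
  obtain a b where ab: "0 < a" "\<forall>\<^sub>F n in sequentially. b \<le> tau_n D S J n a"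
    using tau_n_bounded_below by blast
  have "tau D S J a \<le> tau D S J 0 - ereal a * dim_inf D S J"
    using tau_add_le[of a 0] ab by simp
  moreover have "tau D S J 0 < \<infinity>"
    using order_trans[OF tau_0_le_dim_M dim_M_le] by (cases "tau D S J 0") auto
  ultimately have "tau D S J a = -\<infinity>"
    using ab tau_0_nonneg by (cases "tau D S J 0") (auto simp: inf)
  moreover have "ereal b \<le> limsup (\<lambda>n. ereal (tau_n D S J n a))"
    by (intro le_Limsup) (use ab in auto)
  ultimately show False
    by (simp add: tau_def)
qed

end

section \<open>Bounds for the critical exponent\<close>

theorem proposition1p9:
  fixes Q0 :: "(real ^ 'n) set" and D :: "nat \<Rightarrow> (real ^ 'n) set set"
    and S :: "(real ^ 'n) set set" and J :: "(real ^ 'n) set \<Rightarrow> real"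
  assumes "dyadic_set_function Q0 D S J"
  shows "(1 \<le> crit_exp D S J \<and> crit_exp D S J < \<infinity> \<longrightarrow>
       tau D S J 0 / (tau D S J 0 - tau D S J 1) \<le> crit_exp D S J
     \<and> crit_exp D S J \<le> (dim_inf D S J + tau D S J 1) / dim_inf D S J
     \<and> (dim_inf D S J + tau D S J 1) / dim_inf D S J \<le> tau D S J 0 / dim_inf D S J
     \<and> tau D S J 0 / dim_inf D S J \<le> dim_M D S J / dim_inf D S J
     \<and> dim_M D S J / dim_inf D S J \<le> ereal (real CARD('n)) / dim_inf D S J)
   \<and> (crit_exp D S J \<le> 1 \<longrightarrow>
       (dim_inf D S J + tau D S J 1) / dim_inf D S J \<le> crit_exp D S J
     \<and> crit_exp D S J \<le> tau D S J 0 / (tau D S J 0 - tau D S J 1)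
     \<and> tau D S J 0 / (tau D S J 0 - tau D S J 1) \<le> dim_M D S J / (dim_M D S J - tau D S J 1))"
proof -
  interpret dyadic_set_function Q0 D S J
    by (rule assms)
  obtain M where M: "dim_M D S J = ereal M"
    using tau_0_nonneg tau_0_le_dim_M dim_M_le by (cases "dim_M D S J") auto
  obtain \<delta> where dim_inf_eq: "dim_inf D S J = ereal \<delta>"
    using dim_inf_nonneg dim_inf_finite by (cases "dim_inf D S J") auto
  \<comment> \<open>All values of \<open>\<tau>\<close> at nonnegative exponents are finite, so the rest of the proof is about reals.\<close>
  define T where "T q = real_of_ereal (tau D S J q)" for q
  have T: "tau D S J q = ereal (T q)" if "0 \<le> q" for q
  proof -
    have "tau D S J q \<le> tau D S J 0 - ereal (q * \<delta>)" "tau D S J 0 \<le> ereal M"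
      using tau_add_le[OF that, of 0] tau_0_le_dim_M by (simp_all add: dim_inf_eq M)
    moreover have "- ereal (q * \<delta>) \<le> tau D S J q"
      using tau_ge[OF that] by (simp add: dim_inf_eq)
    ultimately show ?thesis
      unfolding T_def using tau_0_nonneg
      by (cases "tau D S J q"; cases "tau D S J 0") auto
  qed
  note T01 = T[of 0, simplified] T[of 1, simplified]
  have shift: "T (p + r) \<le> T p - r * \<delta>" if "0 \<le> p" "0 \<le> r" for p r
    using tau_add_le[OF that(2), of p] that by (simp add: T dim_inf_eq)
  have lower: "- q * \<delta> \<le> T q" if "0 \<le> q" for q
    using tau_ge[OF that] that by (simp add: T dim_inf_eq)
  have convex: "T (t * q) \<le> (1 - t) * T 0 + t * T q" if "0 \<le> t" "t \<le> 1" "0 \<le> q" for t q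
    using tau_convex[OF that(1,2), of 0 q] that by (simp add: T)
  have \<delta>_nonneg: "0 \<le> \<delta>" and T0_nonneg: "0 \<le> T 0" and T0_le: "T 0 \<le> M" and M_le: "M \<le> real CARD('n)"
    using dim_inf_nonneg tau_0_nonneg tau_0_le_dim_M dim_M_le by (simp_all add: T M dim_inf_eq)
  have T01_diff: "\<delta> \<le> T 0 - T 1"
    using shift[of 0 1] by simp
  have crit: "crit_exp D S J = Inf {ereal q | q. 0 \<le> q \<and> T q < 0}"
    unfolding crit_exp_def by (rule arg_cong[where f = Inf]) (auto simp: T)
  have crit_le: "crit_exp D S J \<le> ereal q" if "0 \<le> q" "T q < 0" for q
    unfolding crit using that by (intro Inf_lower) auto
  have crit_ge: "ereal x \<le> crit_exp D S J" if "\<And>q. 0 \<le> q \<Longrightarrow> T q < 0 \<Longrightarrow> x \<le> q" for x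
    unfolding crit using that by (intro Inf_greatest) auto
  have crit_le_limit: "crit_exp D S J \<le> ereal x" if "\<And>q. x < q \<Longrightarrow> crit_exp D S J \<le> ereal q" for x
  proof (rule ccontr)
    assume "\<not> crit_exp D S J \<le> ereal x"
    then obtain q where "ereal x < ereal q" "ereal q < crit_exp D S J"
      using ereal_dense2[of "ereal x" "crit_exp D S J"] by (auto simp: not_le)
    then show False
      using that[of q] by simp
  qed
  have negative: "\<exists>q. 0 \<le> q \<and> T q < 0 \<and> ereal q < y" if "crit_exp D S J < y" for y
    using that unfolding crit Inf_less_iff by auto
  have \<delta>_pos: "0 < \<delta>" if finite: "crit_exp D S J < \<infinity>"
  proof -
    obtain q where "0 \<le> q" "T q < 0"
      using negative[OF finite] by blast
    with lower[of q] show ?thesis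
      using \<delta>_nonneg by (cases "\<delta> = 0") auto
  qed
  \<comment> \<open>\<open>T 0 < q * (T 0 - T 1)\<close> says that the line through \<open>(0, T 0)\<close> and \<open>(1, T 1)\<close> is negative at \<open>q\<close>.\<close>
  have chord: "T q < 0" if "0 \<le> q" "q \<le> 1" "T 0 < q * (T 0 - T 1)" for q
    using convex[of q 1] that by (simp add: algebra_simps)
  have extended_chord: "T 0 < q * (T 0 - T 1)" if "1 \<le> q" "T q < 0" for q
  proof -
    have "q * T 1 \<le> q * ((1 - 1 / q) * T 0 + 1 / q * T q)"
      using convex[of "1 / q" q] that by (intro mult_left_mono) auto
    also have "\<dots> = (q - 1) * T 0 + T q"
      using that by (simp add: field_simps)
    finally show ?thesis
      using that by (simp add: algebra_simps)
  qed
  show ?thesis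
  proof (rule conjI; rule impI)
    assume crit_asm: "1 \<le> crit_exp D S J \<and> crit_exp D S J < \<infinity>"
    then have \<delta>: "0 < \<delta>"
      by (intro \<delta>_pos) simp
    with T01_diff have diff: "0 < T 0 - T 1" by simp
    have ge_1: "1 \<le> q" if "0 \<le> q" "T q < 0" for q
      using order_trans[OF conjunct1[OF crit_asm] crit_le[OF that]] by simp
    \<comment> \<open>Otherwise the chord over \<open>[0, 1]\<close>, and with it \<open>T\<close>, would be negative somewhere before \<open>1\<close>.\<close>
    have T1: "0 \<le> T 1"
    proof (rule ccontr)
      assume "\<not> 0 \<le> T 1"
      then have "T 0 / (T 0 - T 1) < 1"
        using diff by simp
      then obtain q where q: "T 0 / (T 0 - T 1) < q" "q < 1"
        using dense by blast
      have "0 \<le> T 0 / (T 0 - T 1)"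
        using T0_nonneg diff by simp
      then have "0 \<le> q"
        using q by linarith
      moreover have "T 0 < q * (T 0 - T 1)"
        using q diff by (simp add: pos_divide_less_eq)
      ultimately show False
        using chord[of q] ge_1[of q] q by simp
    qed
    have "ereal (T 0 / (T 0 - T 1)) \<le> crit_exp D S J"
    proof (rule crit_ge)
      fix q :: real assume "0 \<le> q" "T q < 0"
      then show "T 0 / (T 0 - T 1) \<le> q"
        using extended_chord[of q] ge_1[of q] diff by (simp add: pos_divide_le_eq)
    qed
    moreover have "crit_exp D S J \<le> ereal ((\<delta> + T 1) / \<delta>)"
    proof (rule crit_le_limit)
      fix q assume "(\<delta> + T 1) / \<delta> < q"
      then have q: "\<delta> + T 1 < q * \<delta>"
        using \<delta> by (simp add: pos_divide_less_eq)
      then have "1 * \<delta> < q * \<delta>"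
        using T1 by linarith
      then have "1 < q"
        using \<delta> by simp
      then show "crit_exp D S J \<le> ereal q"
        using shift[of 1 "q - 1"] q by (intro crit_le) (auto simp: algebra_simps)
    qed
    moreover have "(\<delta> + T 1) / \<delta> \<le> T 0 / \<delta>" "T 0 / \<delta> \<le> M / \<delta>" "M / \<delta> \<le> real CARD('n) / \<delta>"
      using \<delta> T01_diff T0_le M_le by (simp_all add: divide_right_mono)
    ultimately show "tau D S J 0 / (tau D S J 0 - tau D S J 1) \<le> crit_exp D S J
     \<and> crit_exp D S J \<le> (dim_inf D S J + tau D S J 1) / dim_inf D S J
     \<and> (dim_inf D S J + tau D S J 1) / dim_inf D S J \<le> tau D S J 0 / dim_inf D S J
     \<and> tau D S J 0 / dim_inf D S J \<le> dim_M D S J / dim_inf D S J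
     \<and> dim_M D S J / dim_inf D S J \<le> ereal (real CARD('n)) / dim_inf D S J"
      using \<delta> diff by (simp add: T01 M dim_inf_eq)
  next
    assume crit_asm: "crit_exp D S J \<le> 1"
    then have \<delta>: "0 < \<delta>"
      by (intro \<delta>_pos) auto
    with T01_diff have diff: "0 < T 0 - T 1" by simp
    \<comment> \<open>A negative value before \<open>1\<close> propagates to \<open>1\<close> with slope at most \<open>- \<delta>\<close>.\<close>
    have below_1: "T 1 < - ((1 - q) * \<delta>)" if "0 \<le> q" "q \<le> 1" "T q < 0" for q
      using shift[of q "1 - q"] that by simp
    \<comment> \<open>Otherwise the chord vanishes only beyond \<open>1\<close>, and \<open>T\<close> cannot be negative before its zero.\<close>
    have T1: "T 1 \<le> 0"
    proof (rule ccontr)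
      assume pos: "\<not> T 1 \<le> 0"
      then have "1 < T 0 / (T 0 - T 1)"
        using diff by simp
      then have "crit_exp D S J < ereal (T 0 / (T 0 - T 1))"
        using crit_asm by (simp add: order.strict_trans1)
      then obtain q where q: "0 \<le> q" "T q < 0" "q < T 0 / (T 0 - T 1)"
        using negative by (metis less_ereal.simps(1))
      then have "\<not> T 0 < q * (T 0 - T 1)"
        using diff by (simp add: pos_less_divide_eq)
      then have "q \<le> 1"
        using extended_chord[of q] q by linarith
      then have "T 1 < - ((1 - q) * \<delta>)" "0 \<le> (1 - q) * \<delta>"
        using below_1 q \<delta> by simp_all
      then show False
        using pos by linarith
    qed
    have "ereal ((\<delta> + T 1) / \<delta>) \<le> crit_exp D S J"
    proof (rule crit_ge)
      fix q :: real assume q: "0 \<le> q" "T q < 0"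
      have "\<delta> + T 1 \<le> q * \<delta>"
      proof (cases "q \<le> 1")
        case True
        then show ?thesis
          using below_1[of q] q by (simp add: algebra_simps)
      next
        case False
        then have "1 * \<delta> \<le> q * \<delta>"
          using \<delta> by (intro mult_right_mono) auto
        then show ?thesis
          using T1 by simp
      qed
      then show "(\<delta> + T 1) / \<delta> \<le> q"
        using \<delta> by (simp add: pos_divide_le_eq)
    qed
    moreover have "crit_exp D S J \<le> ereal (T 0 / (T 0 - T 1))"
    proof (rule crit_le_limit)
      fix q assume q: "T 0 / (T 0 - T 1) < q"
      show "crit_exp D S J \<le> ereal q"
      proof (cases "q \<le> 1")
        case True
        have "0 \<le> T 0 / (T 0 - T 1)"
          using T0_nonneg diff by simp
        then have "0 \<le> q"
          using q by linarith
        then show ?thesis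
          using q diff True by (intro crit_le chord) (simp_all add: pos_divide_less_eq)
      next
        case False
        then show ?thesis
          by (intro order_trans[OF crit_asm]) simp
      qed
    qed
    moreover have "T 0 / (T 0 - T 1) \<le> M / (M - T 1)"
    proof -
      have "M * T 1 \<le> T 0 * T 1"
        using T0_le T1 by (rule mult_right_mono_neg)
      then have "T 0 * (M - T 1) \<le> M * (T 0 - T 1)"
        by (simp add: algebra_simps)
      then show ?thesis
        using diff T0_le by (simp add: divide_le_eq pos_le_divide_eq)
    qed
    ultimately show "(dim_inf D S J + tau D S J 1) / dim_inf D S J \<le> crit_exp D S J
     \<and> crit_exp D S J \<le> tau D S J 0 / (tau D S J 0 - tau D S J 1)
     \<and> tau D S J 0 / (tau D S J 0 - tau D S J 1) \<le> dim_M D S J / (dim_M D S J - tau D S J 1)"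
      using \<delta> diff T0_le by (simp add: T01 M dim_inf_eq)
  qed
qed

end
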